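(* Let $\bar\delta>0$ and let $(L_\delta)_{\delta\in[0,\bar\delta)}$ be a family of Markov operators preserving $B_{ss}$, $B_s$ and $B_w$. Suppose that for each $\delta\in[0,\bar\delta)$ there is $f_\delta\in B_{ss}$ which is a fixed probability measure of $L_\delta$. Suppose: (1) (summable convergence) there is $\phi$ with $\sum_n\phi(n)<\infty$ such that $L_0$ has convergence to equilibrium with respect to $B_s$, $B_w$ with speed $\phi$, that is, $\|L_0^nf\|_w\le\phi(n)\|f\|_s$ for all $f\in V_s$ and all $n$; (2) (strong statistical stability) $\lim_{\delta\to0}\|f_\delta-f_0\|_{ss}=0$; (3) (derivative operator) there is a continuous operator $\dot L:B_{ss}\to V_s$ such that for each $f\in B_{ss}$ $$\lim_{\delta\to0}\left\|\frac{L_\delta-L_0}{\delta}f-\dot Lf\right\|_s=0.$$ Then $$\lim_{\delta\to0}\left\|\frac{f_\delta-f_0}{\delta}-(1-L_0)^{-1}\dot Lf_0\right\|_w=0,$$ where $(1-L_0)^{-1}:=\sum_{i=0}^\infty L_0^i$ is a continuous operator $V_s\to V_w$.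
   Context: $X$ is a compact metric space and $SM(X)$ is the space of signed Borel measures on $X$. $(B_{ss},\|\cdot\|_{ss})\subseteq(B_s,\|\cdot\|_s)\subseteq(B_w,\|\cdot\|_w)\subseteq SM(X)$ are complete normed vector subspaces with $\|\cdot\|_w\le\|\cdot\|_s\le\|\cdot\|_{ss}$, and the linear form $\mu\mapsto\mu(X)$ is continuous on $B_i$ for $i\in\{ss,s,w\}$. $V_i=\{\mu\in B_i:\mu(X)=0\}$ for $i\in\{ss,s,w\}$. A Markov operator is a linear operator $L$ mapping positive measures to positive measures with $[L\mu](X)=\mu(X)$ for each signed measure $\mu$. Preserving the spaces means $L_\delta(B_{i})\subseteq B_{i}$ for $i\in\{ss,s,w\}$. A speed of convergence to equilibrium is a function $\phi:\mathbb N\to\mathbb R$ with $\phi(n)\to0$. The series $\sum_i L_0^if$, for $f\in V_s$, converges in $\|\cdot\|_w$.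
   Formalization: Each operator L_δ is additionally assumed continuous from (B_ss, ‖·‖_ss) to (B_s, ‖·‖_s); with only the inclusions L_δ(B_i) ⊆ B_i the claim fails for complete norms unrelated to the topology of SM(X). *)

theory Defs
  imports "HOL-Analysis.Analysis"
begin

(* Finite signed Borel measures. The value 0 off the Borel sets makes equality of
   elements coincide with equality as set functions on the Borel sigma-algebra. *)
typedef (overloaded) ('a::topological_space) signed_measure =
  "{\<mu> :: 'a set \<Rightarrow> real.
      (\<forall>A. A \<notin> sets borel \<longrightarrow> \<mu> A = 0) \<and> \<mu> {} = 0 \<and>
      (\<forall>A :: nat \<Rightarrow> 'a set. range A \<subseteq> sets borel \<and> disjoint_family A \<longrightarrow>
         (\<lambda>i. \<mu> (A i)) sums \<mu> (\<Union>i. A i))}"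
  morphisms smeasure Abs_signed_measure
  by (rule exI[of _ "\<lambda>_. 0"]) auto

setup_lifting type_definition_signed_measure

instantiation signed_measure :: (topological_space) real_vector
begin

lift_definition zero_signed_measure :: "'a signed_measure" is "\<lambda>_. 0"
  by auto

lift_definition plus_signed_measure ::
  "'a signed_measure \<Rightarrow> 'a signed_measure \<Rightarrow> 'a signed_measure" is "\<lambda>\<mu> \<nu> A. \<mu> A + \<nu> A"
  by (auto intro!: sums_add)

lift_definition minus_signed_measure ::
  "'a signed_measure \<Rightarrow> 'a signed_measure \<Rightarrow> 'a signed_measure" is "\<lambda>\<mu> \<nu> A. \<mu> A - \<nu> A"
  by (auto intro!: sums_diff)

lift_definition uminus_signed_measure ::
  "'a signed_measure \<Rightarrow> 'a signed_measure" is "\<lambda>\<mu> A. - \<mu> A"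
  by (auto intro!: sums_minus)

lift_definition scaleR_signed_measure ::
  "real \<Rightarrow> 'a signed_measure \<Rightarrow> 'a signed_measure" is "\<lambda>c \<mu> A. c * \<mu> A"
  by (auto intro!: sums_mult)

instance
  by standard (transfer; auto simp: fun_eq_iff algebra_simps)+

end

definition mass :: "'a::topological_space signed_measure \<Rightarrow> real"
  where "mass \<mu> = smeasure \<mu> UNIV"

definition positive_measure :: "'a::topological_space signed_measure \<Rightarrow> bool"
  where "positive_measure \<mu> \<longleftrightarrow> (\<forall>A \<in> sets borel. 0 \<le> smeasure \<mu> A)"

definition probability_measure :: "'a::topological_space signed_measure \<Rightarrow> bool"
  where "probability_measure \<mu> \<longleftrightarrow> positive_measure \<mu> \<and> mass \<mu> = 1"

definition markov_operator ::
  "('a::topological_space signed_measure \<Rightarrow> 'a signed_measure) \<Rightarrow> bool"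
  where "markov_operator L \<longleftrightarrow>
    linear L \<and> (\<forall>\<mu>. positive_measure \<mu> \<longrightarrow> positive_measure (L \<mu>)) \<and>
    (\<forall>\<mu>. mass (L \<mu>) = mass \<mu>)"

(* A normed space carried by a subspace B is represented by the pair of B and a function N
   whose values matter only on B: several norms live on different subspaces of one vector
   space, so the class real_normed_vector does not apply. *)
definition normed_subspace :: "'v::real_vector set \<Rightarrow> ('v \<Rightarrow> real) \<Rightarrow> bool"
  where "normed_subspace B N \<longleftrightarrow> subspace B \<and>
    (\<forall>x\<in>B. 0 \<le> N x \<and> (N x = 0 \<longleftrightarrow> x = 0)) \<and>
    (\<forall>x\<in>B. \<forall>c. N (c *\<^sub>R x) = \<bar>c\<bar> * N x) \<and>
    (\<forall>x\<in>B. \<forall>y\<in>B. N (x + y) \<le> N x + N y)"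

definition complete_normed_subspace :: "'v::real_vector set \<Rightarrow> ('v \<Rightarrow> real) \<Rightarrow> bool"
  where "complete_normed_subspace B N \<longleftrightarrow> normed_subspace B N \<and>
    (\<forall>u :: nat \<Rightarrow> 'v. range u \<subseteq> B \<and>
       (\<forall>e>0. \<exists>k. \<forall>m\<ge>k. \<forall>n\<ge>k. N (u m - u n) < e) \<longrightarrow>
       (\<exists>x\<in>B. (\<lambda>n. N (u n - x)) \<longlonglongrightarrow> 0))"

definition norm_continuous ::
  "'v::real_vector set \<Rightarrow> ('v \<Rightarrow> real) \<Rightarrow> ('w::real_vector \<Rightarrow> real) \<Rightarrow> ('v \<Rightarrow> 'w) \<Rightarrow> bool"
  where "norm_continuous B N M T \<longleftrightarrow>
    (\<forall>x\<in>B. \<forall>e>0. \<exists>d>0. \<forall>y\<in>B. N (y - x) < d \<longrightarrow> M (T y - T x) < e)"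

definition continuous_operator ::
  "'v::real_vector set \<Rightarrow> ('v \<Rightarrow> real) \<Rightarrow> 'w::real_vector set \<Rightarrow> ('w \<Rightarrow> real) \<Rightarrow> ('v \<Rightarrow> 'w) \<Rightarrow> bool"
  where "continuous_operator B N C M T \<longleftrightarrow>
    T ` B \<subseteq> C \<and>
    (\<forall>x\<in>B. \<forall>y\<in>B. T (x + y) = T x + T y) \<and> (\<forall>c. \<forall>x\<in>B. T (c *\<^sub>R x) = c *\<^sub>R T x) \<and>
    norm_continuous B N M T"

definition zero_mass :: "'a::topological_space signed_measure set \<Rightarrow> 'a signed_measure set"
  where "zero_mass B = {\<mu> \<in> B. mass \<mu> = 0}"

definition convergence_to_equilibrium ::
  "('a::topological_space signed_measure \<Rightarrow> 'a signed_measure) \<Rightarrow>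
   'a signed_measure set \<Rightarrow> ('a signed_measure \<Rightarrow> real) \<Rightarrow> ('a signed_measure \<Rightarrow> real) \<Rightarrow>
   (nat \<Rightarrow> real) \<Rightarrow> bool"
  where "convergence_to_equilibrium L Bs Ns Nw \<phi> \<longleftrightarrow>
    \<phi> \<longlonglongrightarrow> 0 \<and> (\<forall>f \<in> zero_mass Bs. \<forall>n. Nw ((L ^^ n) f) \<le> \<phi> n * Ns f)"

definition norm_sums ::
  "'v::real_vector set \<Rightarrow> ('v \<Rightarrow> real) \<Rightarrow> (nat \<Rightarrow> 'v) \<Rightarrow> 'v \<Rightarrow> bool"
  where "norm_sums B N u g \<longleftrightarrow> g \<in> B \<and> (\<lambda>n. N ((\<Sum>i<n. u i) - g)) \<longlonglongrightarrow> 0"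

(* Meaningful only where the series converges in (B, N). *)
definition neumann_series ::
  "('v::real_vector \<Rightarrow> 'v) \<Rightarrow> 'v set \<Rightarrow> ('v \<Rightarrow> real) \<Rightarrow> 'v \<Rightarrow> 'v"
  where "neumann_series L B N f = (THE g. norm_sums B N (\<lambda>i. (L ^^ i) f) g)"

end

theory Submission
  imports Defs
begin

text \<open>
  Write \<open>h = f\<^sub>\<delta> - f\<^sub>0\<close>. Both measures have mass one, so \<open>h \<in> V\<^sub>s\<close>, and the two fixed point
  equations give \<open>(1 - L\<^sub>0) (h / \<delta>) = g\<^sub>\<delta>\<close> with \<open>g\<^sub>\<delta> = ((L\<^sub>\<delta> - L\<^sub>0) / \<delta>) f\<^sub>\<delta>\<close>. The partial sums of
  \<open>\<Sum>i. L\<^sub>0\<^sup>i g\<^sub>\<delta>\<close> telescope to \<open>h / \<delta> - L\<^sub>0\<^sup>n h / \<delta>\<close>, which converges to \<open>h / \<delta>\<close> in the weak norm. Hence the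
  difference quotient of the invariant measures is exactly \<open>R g\<^sub>\<delta>\<close>, where \<open>R\<close> is the Neumann series
  of \<open>L\<^sub>0\<close> (\<open>norm_sums_telescope\<close>). Summability of \<open>\<phi>\<close> makes \<open>R\<close> a bounded operator from the
  strong to the weak norm, with bound \<open>\<Sum>n. \<phi> n\<close> (\<open>neumann_bound\<close>), so it remains to
  show that \<open>g\<^sub>\<delta>\<close> tends to \<open>Ldot f\<^sub>0\<close> in the strong norm.

  The derivative hypothesis is only a pointwise one, while the argument \<open>f\<^sub>\<delta>\<close> moves with \<open>\<delta>\<close>. The
  passage from one to the other is the Banach--Steinhaus theorem: along any sequence
  \<open>\<delta>\<^sub>n \<rightarrow> 0\<close> the operators \<open>(L\<^sub>\<delta> - L\<^sub>0) / \<delta>\<close> are continuous on the complete space \<open>B\<^sub>s\<^sub>s\<close> and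
  pointwise convergent, hence uniformly bounded, and then strong statistical stability
  \<open>f\<^sub>\<delta> \<rightarrow> f\<^sub>0\<close> suffices (\<open>operators_converge_at_moving_point\<close>).
\<close>

section \<open>Normed subspaces\<close>

lemma normed_subspaceD:
  assumes "normed_subspace B N"
  shows "subspace B"
    and "x \<in> B \<Longrightarrow> 0 \<le> N x"
    and "x \<in> B \<Longrightarrow> N x = 0 \<longleftrightarrow> x = 0"
    and "x \<in> B \<Longrightarrow> N (c *\<^sub>R x) = \<bar>c\<bar> * N x"
    and "x \<in> B \<Longrightarrow> y \<in> B \<Longrightarrow> N (x + y) \<le> N x + N y"
  using assms unfolding normed_subspace_def by simp_all

lemma normed_subspace_minus:
  assumes "normed_subspace B N" "x \<in> B"
  shows "N (- x) = N x"
  using normed_subspaceD(4)[OF assms, of "-1"] by simp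

lemma normed_subspace_diff:
  assumes "normed_subspace B N" "x \<in> B" "y \<in> B"
  shows "N (x - y) \<le> N x + N y"
  using normed_subspaceD(5)[OF assms(1,2), of "- y"] normed_subspace_minus[OF assms(1,3)]
    subspace_neg[OF normed_subspaceD(1)[OF assms(1)] assms(3)]
  by simp

lemma normed_subspace_diff_commute:
  assumes "normed_subspace B N" "x \<in> B" "y \<in> B"
  shows "N (x - y) = N (y - x)"
  using normed_subspace_minus[OF assms(1), of "x - y"]
    subspace_diff[OF normed_subspaceD(1)[OF assms(1)] assms(2,3)]
  by simp

lemma normed_subspace_diff_triangle:
  assumes "normed_subspace B N" "x \<in> B" "y \<in> B" "z \<in> B"
  shows "N (x - z) \<le> N (x - y) + N (y - z)"
  using normed_subspaceD(5)[OF assms(1), of "x - y" "y - z"]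
    subspace_diff[OF normed_subspaceD(1)[OF assms(1)]] assms(2-4)
  by simp

lemma normed_subspace_sum:
  assumes B: "normed_subspace B N" and u: "\<And>i. i \<in> I \<Longrightarrow> u i \<in> B"
  shows "N (sum u I) \<le> (\<Sum>i\<in>I. N (u i))"
  using u
proof (induction I rule: infinite_finite_induct)
  case (insert i I)
  have "sum u I \<in> B"
    using insert.prems by (intro subspace_sum normed_subspaceD(1)[OF B]) auto
  then have "N (u i + sum u I) \<le> N (u i) + N (sum u I)"
    using insert.prems by (intro normed_subspaceD(5)[OF B]) auto
  moreover have "N (sum u I) \<le> (\<Sum>i\<in>I. N (u i))"
    using insert.IH insert.prems by simp
  ultimately show ?case using insert.hyps by simp
qed (use normed_subspaceD(3)[OF B, of 0] subspace_0[OF normed_subspaceD(1)[OF B]] in simp_all)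

lemma normed_subspace_subset:
  assumes "normed_subspace B N" "subspace C" "C \<subseteq> B"
  shows "normed_subspace C N"
  using assms(1,2) subsetD[OF assms(3)] unfolding normed_subspace_def by simp

lemma complete_normed_subspace_normed:
  "complete_normed_subspace B N \<Longrightarrow> normed_subspace B N"
  by (simp add: complete_normed_subspace_def)

lemma complete_normed_subspace_limit:
  assumes "complete_normed_subspace B N" "\<And>n. u n \<in> B"
    and "\<forall>e>0. \<exists>k. \<forall>m\<ge>k. \<forall>n\<ge>k. N (u m - u n) < e"
  shows "\<exists>x\<in>B. (\<lambda>n. N (u n - x)) \<longlonglongrightarrow> 0"
  using assms unfolding complete_normed_subspace_def by (simp add: image_subset_iff)

text \<open>
  The metric of a normed subspace is extended by 0 outside the subspace, because
  \<^locale>\<open>Metric_space\<close> demands nonnegativity and symmetry on the whole type.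
\<close>

definition norm_dist :: "'v::real_vector set \<Rightarrow> ('v \<Rightarrow> real) \<Rightarrow> 'v \<Rightarrow> 'v \<Rightarrow> real"
  where "norm_dist B N x y = (if x \<in> B \<and> y \<in> B then N (x - y) else 0)"

lemma Metric_space_norm_dist:
  assumes B: "normed_subspace B N"
  shows "Metric_space B (norm_dist B N)"
proof
  have diff: "x - y \<in> B" if "x \<in> B" "y \<in> B" for x y
    using that subspace_diff normed_subspaceD(1)[OF B] by blast
  fix x y z
  show "0 \<le> norm_dist B N x y"
    using normed_subspaceD(2)[OF B diff] by (simp add: norm_dist_def)
  show "norm_dist B N x y = norm_dist B N y x"
    using normed_subspace_diff_commute[OF B, of x y] by (simp add: norm_dist_def)
  show "norm_dist B N x y = 0 \<longleftrightarrow> x = y" if "x \<in> B" "y \<in> B"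
    using that normed_subspaceD(3)[OF B diff] by (simp add: norm_dist_def)
  show "norm_dist B N x z \<le> norm_dist B N x y + norm_dist B N y z"
    if "x \<in> B" "y \<in> B" "z \<in> B"
    using normed_subspace_diff_triangle[OF B that] that by (simp add: norm_dist_def)
qed

lemma mcomplete_norm_dist:
  assumes B: "complete_normed_subspace B N"
  shows "Metric_space.mcomplete B (norm_dist B N)"
proof -
  note nB = complete_normed_subspace_normed[OF B]
  interpret Metric_space B "norm_dist B N"
    by (rule Metric_space_norm_dist[OF nB])
  show ?thesis
    unfolding mcomplete_def
  proof (intro allI impI)
    fix u :: "nat \<Rightarrow> 'a"
    assume "MCauchy u"
    then have u: "range u \<subseteq> B"
      and cau: "\<forall>e>0. \<exists>k. \<forall>m\<ge>k. \<forall>n\<ge>k. norm_dist B N (u m) (u n) < e"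
      by (simp_all add: MCauchy_def)
    have eq: "norm_dist B N (u m) y = N (u m - y)" if "y \<in> B" for m y
      using u that by (auto simp: norm_dist_def)
    have "\<forall>e>0. \<exists>k. \<forall>m\<ge>k. \<forall>n\<ge>k. N (u m - u n) < e"
      using cau eq[of "u n" for n] u by (simp add: image_subset_iff)
    then obtain x where x: "x \<in> B" "(\<lambda>n. N (u n - x)) \<longlonglongrightarrow> 0"
      using complete_normed_subspace_limit[OF B, of u] u by blast
    have "limitin mtopology u x sequentially"
      using x u eq[OF x(1)] by (subst limitin_metric_dist_null) (simp add: image_subset_iff)
    then show "\<exists>x. limitin mtopology u x sequentially" ..
  qed
qed


section \<open>Uniform boundedness\<close>

lemma continuous_operatorD:
  assumes "continuous_operator B N C M T"
  shows "x \<in> B \<Longrightarrow> T x \<in> C"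
    and "x \<in> B \<Longrightarrow> y \<in> B \<Longrightarrow> T (x + y) = T x + T y"
    and "x \<in> B \<Longrightarrow> T (c *\<^sub>R x) = c *\<^sub>R T x"
    and "norm_continuous B N M T"
  using assms unfolding continuous_operator_def by auto

lemma continuous_operator_diff_eq:
  assumes T: "continuous_operator B N C M T" and B: "subspace B" and x: "x \<in> B" and y: "y \<in> B"
  shows "T (x - y) = T x - T y"
  using continuous_operatorD(2)[OF T subspace_diff[OF B x y] y] by (simp add: algebra_simps)

lemma continuous_operator_diff:
  assumes B: "subspace B" and C: "normed_subspace C M"
    and S: "continuous_operator B N C M S" and T: "continuous_operator B N C M T"
  shows "continuous_operator B N C M (\<lambda>x. S x - T x)"
proof -
  note mem = continuous_operatorD(1)[OF S] continuous_operatorD(1)[OF T]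
  note sub = normed_subspaceD(1)[OF C]
  have "norm_continuous B N M (\<lambda>x. S x - T x)"
    unfolding norm_continuous_def
  proof (intro ballI allI impI)
    fix x and e :: real
    assume x: "x \<in> B" and e: "e > 0"
    obtain d1 where d1: "d1 > 0" "\<And>y. y \<in> B \<Longrightarrow> N (y - x) < d1 \<Longrightarrow> M (S y - S x) < e / 2"
      using continuous_operatorD(4)[OF S] x e unfolding norm_continuous_def
      by (meson half_gt_zero)
    obtain d2 where d2: "d2 > 0" "\<And>y. y \<in> B \<Longrightarrow> N (y - x) < d2 \<Longrightarrow> M (T y - T x) < e / 2"
      using continuous_operatorD(4)[OF T] x e unfolding norm_continuous_def
      by (meson half_gt_zero)
    have "M (S y - T y - (S x - T x)) < e" if y: "y \<in> B" "N (y - x) < min d1 d2" for y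
    proof -
      have "S y - T y - (S x - T x) = (S y - S x) - (T y - T x)" by simp
      also have "M \<dots> \<le> M (S y - S x) + M (T y - T x)"
        using mem x y(1) by (intro normed_subspace_diff[OF C] subspace_diff[OF sub]) auto
      also have "\<dots> < e" using d1(2)[of y] d2(2)[of y] y by simp
      finally show ?thesis .
    qed
    then show "\<exists>d>0. \<forall>y\<in>B. N (y - x) < d \<longrightarrow> M (S y - T y - (S x - T x)) < e"
      using d1(1) d2(1) by (intro exI[of _ "min d1 d2"]) auto
  qed
  then show ?thesis
    using mem continuous_operatorD(2,3)[OF S] continuous_operatorD(2,3)[OF T]
    unfolding continuous_operator_def
    by (auto simp: algebra_simps subspace_diff[OF sub])
qed

lemma continuous_operator_scaleR:
  assumes C: "normed_subspace C M" and T: "continuous_operator B N C M T"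
  shows "continuous_operator B N C M (\<lambda>x. c *\<^sub>R T x)"
proof -
  note mem = continuous_operatorD(1)[OF T]
  note sub = normed_subspaceD(1)[OF C]
  have "norm_continuous B N M (\<lambda>x. c *\<^sub>R T x)"
    unfolding norm_continuous_def
  proof (intro ballI allI impI)
    fix x and e :: real
    assume x: "x \<in> B" and e: "e > 0"
    have "e / (\<bar>c\<bar> + 1) > 0" using e by (simp add: add_nonneg_pos)
    then obtain d where d: "d > 0" "\<And>y. y \<in> B \<Longrightarrow> N (y - x) < d \<Longrightarrow> M (T y - T x) < e / (\<bar>c\<bar> + 1)"
      using continuous_operatorD(4)[OF T] x unfolding norm_continuous_def by meson
    have "M (c *\<^sub>R T y - c *\<^sub>R T x) < e" if y: "y \<in> B" "N (y - x) < d" for y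
    proof -
      have dif: "T y - T x \<in> C" using mem x y(1) by (intro subspace_diff[OF sub]) auto
      have "M (c *\<^sub>R T y - c *\<^sub>R T x) = \<bar>c\<bar> * M (T y - T x)"
        using normed_subspaceD(4)[OF C dif] by (simp add: algebra_simps)
      also have "\<dots> \<le> (\<bar>c\<bar> + 1) * M (T y - T x)"
        using normed_subspaceD(2)[OF C dif] by (intro mult_right_mono) auto
      also have "\<dots> < e"
        using d(2)[OF y] by (simp add: field_simps add_nonneg_pos)
      finally show ?thesis .
    qed
    then show "\<exists>d>0. \<forall>y\<in>B. N (y - x) < d \<longrightarrow> M (c *\<^sub>R T y - c *\<^sub>R T x) < e"
      using d(1) by blast
  qed
  then show ?thesis
    using mem continuous_operatorD(2,3)[OF T]
    unfolding continuous_operator_def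
    by (auto simp: algebra_simps subspace_scale[OF sub])
qed

text \<open>
  The sets to which the Baire category theorem is applied below.
\<close>

lemma closedin_operator_sublevel:
  assumes B: "normed_subspace B N" and C: "normed_subspace C M"
    and T: "\<And>n. continuous_operator B N C M (T n)"
  shows "closedin (Metric_space.mtopology B (norm_dist B N)) {x \<in> B. \<forall>n. M (T n x) \<le> k}"
proof -
  interpret Metric_space B "norm_dist B N"
    by (rule Metric_space_norm_dist[OF B])
  have "\<exists>r>0. mball x r \<subseteq> B - {x \<in> B. \<forall>n. M (T n x) \<le> k}"
    if x: "x \<in> B" and n: "k < M (T n x)" for x n
  proof -
    have "M (T n x) - k > 0" using n by simp
    then obtain d where d: "d > 0" "\<And>y. y \<in> B \<Longrightarrow> N (y - x) < d \<Longrightarrow> M (T n y - T n x) < M (T n x) - k"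
      using continuous_operatorD(4)[OF T[of n]] x unfolding norm_continuous_def by meson
    have "k < M (T n y)" if y: "y \<in> mball x d" for y
    proof -
      from y have yB: "y \<in> B" by simp
      note mem = continuous_operatorD(1)[OF T[of n] x] continuous_operatorD(1)[OF T[of n] yB]
      have "N (y - x) < d"
        using y x yB normed_subspace_diff_commute[OF B x yB] by (simp add: norm_dist_def)
      then have "M (T n y - T n x) < M (T n x) - k" using d yB by blast
      moreover have "M (T n x) \<le> M (T n y) + M (T n y - T n x)"
        using normed_subspace_diff[OF C mem(2), of "T n y - T n x"]
          subspace_diff[OF normed_subspaceD(1)[OF C] mem(2,1)] by simp
      ultimately show ?thesis by simp
    qed
    then have "mball x d \<subseteq> B - {x \<in> B. \<forall>n. M (T n x) \<le> k}"
      using mball_subset_mspace by (auto simp: subset_iff not_le simp del: in_mball)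
    with d(1) show ?thesis by blast
  qed
  then show ?thesis
    unfolding closedin_def openin_mtopology by (auto simp: not_le)
qed

text \<open>
  Banach--Steinhaus. By the Baire category theorem one of the closed sets on which all operators
  are bounded by \<open>k\<close> contains a ball around some \<open>x0\<close>; differences of points of that ball fill a ball
  around 0, so the operators are bounded by \<open>2 * k\<close> there, and scaling gives the bound everywhere.
\<close>

lemma uniform_boundedness:
  fixes T :: "nat \<Rightarrow> 'v::real_vector \<Rightarrow> 'w::real_vector"
  assumes B: "complete_normed_subspace B N" and C: "normed_subspace C M"
    and T: "\<And>n. continuous_operator B N C M (T n)"
    and pointwise: "\<And>x. x \<in> B \<Longrightarrow> \<exists>K. \<forall>n. M (T n x) \<le> K"
  obtains K where "\<And>n x. x \<in> B \<Longrightarrow> M (T n x) \<le> K * N x"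
proof -
  note nB = complete_normed_subspace_normed[OF B]
  note sB = normed_subspaceD(1)[OF nB]
  note mem = continuous_operatorD(1)[OF T]
  interpret Metric_space B "norm_dist B N"
    by (rule Metric_space_norm_dist[OF nB])
  define F where "F k = {x \<in> B. \<forall>n. M (T n x) \<le> real k}" for k :: nat
  have closed: "closedin mtopology (F k)" for k
    unfolding F_def by (rule closedin_operator_sublevel[OF nB C T])
  have "x \<in> \<Union>(range F)" if x: "x \<in> B" for x
  proof -
    obtain K where K: "\<And>n. M (T n x) \<le> K" using pointwise[OF x] by blast
    obtain k :: nat where "K \<le> real k" using real_arch_simple by blast
    with K have "x \<in> F k" unfolding F_def using x order_trans by blast
    then show ?thesis by blast
  qed
  then have "\<Union>(range F) = topspace mtopology" by (auto simp: F_def)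
  then have "mtopology interior_of \<Union>(range F) = topspace mtopology"
    by (simp only: interior_of_topspace)
  then have "mtopology interior_of \<Union>(range F) \<noteq> {}"
    using subspace_0[OF sB] by auto
  then obtain k where "mtopology interior_of F k \<noteq> {}"
    using metric_Baire_category_alt[OF mcomplete_norm_dist[OF B], of "range F"] closed by auto
  then obtain x0 where x0i: "x0 \<in> mtopology interior_of F k" by blast
  then obtain r where r: "r > 0" "mball x0 r \<subseteq> mtopology interior_of F k"
    using openin_interior_of openin_mtopology by metis
  have ball: "mball x0 r \<subseteq> F k" using r(2) interior_of_subset by (rule order_trans)
  have x0: "x0 \<in> F k" using interior_of_subset x0i by (rule subsetD)
  then have x0B: "x0 \<in> B" by (simp add: F_def)
  have small: "M (T n y) \<le> 2 * real k" if y: "y \<in> B" "N y < r" for n y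
  proof -
    have sum: "x0 + y \<in> B" using x0B y(1) sB by (simp add: subspace_add)
    have "x0 + y \<in> mball x0 r"
      using sum x0B y normed_subspace_minus[OF nB y(1)] by (simp add: norm_dist_def)
    then have "x0 + y \<in> F k" using ball by (rule subsetD[rotated])
    then have "M (T n (x0 + y)) \<le> real k" "M (T n x0) \<le> real k" using x0 by (auto simp: F_def)
    moreover have "T n y = T n (x0 + y) - T n x0"
      using continuous_operatorD(2)[OF T x0B y(1)] by simp
    moreover have "M (T n (x0 + y) - T n x0) \<le> M (T n (x0 + y)) + M (T n x0)"
      using normed_subspace_diff[OF C mem[OF sum] mem[OF x0B]] .
    ultimately show ?thesis by simp
  qed
  have "M (T n x) \<le> (4 * real k / r) * N x" if x: "x \<in> B" for n x
  proof (cases "x = 0")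
    case True
    then have "T n x = 0" using continuous_operatorD(3)[OF T x, of n 0] by simp
    then show ?thesis
      using True normed_subspaceD(3)[OF C, of 0] subspace_0[OF normed_subspaceD(1)[OF C]]
        normed_subspaceD(3)[OF nB x] by simp
  next
    case False
    then have pos: "N x > 0" using normed_subspaceD(2,3)[OF nB x] by simp
    define c where "c = r / (2 * N x)"
    have c: "c > 0" using pos r(1) by (simp add: c_def)
    have "N (c *\<^sub>R x) < r"
      using normed_subspaceD(4)[OF nB x, of c] c pos r(1) by (simp add: c_def)
    then have "M (T n (c *\<^sub>R x)) \<le> 2 * real k"
      using small subspace_scale[OF sB x] by blast
    then have "c * M (T n x) \<le> 2 * real k"
      using continuous_operatorD(3)[OF T x] normed_subspaceD(4)[OF C mem[OF x], of c n] c by simp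
    then show ?thesis using pos r(1) by (simp add: c_def field_simps)
  qed
  then show thesis by (rule that)
qed

text \<open>
  Split \<open>T\<^sub>n x\<^sub>n - z = T\<^sub>n (x\<^sub>n - x) + (T\<^sub>n x - z)\<close>. Pointwise convergence
  controls the second summand, and it bounds the orbits \<open>T\<^sub>n y\<close>, so uniform boundedness
  controls the first.
\<close>

lemma operators_converge_at_moving_point:
  fixes T :: "nat \<Rightarrow> 'v::real_vector \<Rightarrow> 'w::real_vector"
  assumes B: "complete_normed_subspace B N" and C: "normed_subspace C M"
    and T: "\<And>n. continuous_operator B N C M (T n)"
    and limit: "\<And>y. y \<in> B \<Longrightarrow> S y \<in> C" "\<And>y. y \<in> B \<Longrightarrow> (\<lambda>n. M (T n y - S y)) \<longlonglongrightarrow> 0"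
    and X: "\<And>n. X n \<in> B" and x: "x \<in> B" and conv: "(\<lambda>n. N (X n - x)) \<longlonglongrightarrow> 0"
  shows "(\<lambda>n. M (T n (X n) - S x)) \<longlonglongrightarrow> 0"
proof -
  note nB = complete_normed_subspace_normed[OF B]
  note sB = normed_subspaceD(1)[OF nB]
  note sC = normed_subspaceD(1)[OF C]
  note mem = continuous_operatorD(1)[OF T]
  have "\<exists>K. \<forall>n. M (T n y) \<le> K" if y: "y \<in> B" for y
  proof -
    obtain K where K: "\<And>n. \<bar>M (T n y - S y)\<bar> \<le> K"
      using convergent_imp_Bseq[OF convergentI[OF limit(2)[OF y]]] by (auto simp: Bseq_def)
    have "M (T n y) \<le> K + M (S y)" for n
      using normed_subspaceD(5)[OF C, of "T n y - S y" "S y"] K[of n]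
        subspace_diff[OF sC mem[OF y] limit(1)[OF y]] limit(1)[OF y] by simp
    then show ?thesis by blast
  qed
  then obtain K where K: "\<And>n y. y \<in> B \<Longrightarrow> M (T n y) \<le> K * N y"
    using uniform_boundedness[of B N C M T, OF B C T] by blast
  have upper: "M (T n (X n) - S x) \<le> K * N (X n - x) + M (T n x - S x)" for n
  proof -
    have d: "X n - x \<in> B" using subspace_diff[OF sB X x] .
    have "T n (X n) - S x = T n (X n - x) + (T n x - S x)"
      using continuous_operator_diff_eq[OF T sB X x] by simp
    also have "M \<dots> \<le> M (T n (X n - x)) + M (T n x - S x)"
      by (intro normed_subspaceD(5)[OF C] mem[OF d] subspace_diff[OF sC] mem[OF x] limit(1)[OF x])
    finally show ?thesis using K[OF d, of n] by simp
  qed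
  have lower: "0 \<le> M (T n (X n) - S x)" for n
    by (intro normed_subspaceD(2)[OF C] subspace_diff[OF sC] mem[OF X] limit(1)[OF x])
  have "(\<lambda>n. K * N (X n - x) + M (T n x - S x)) \<longlonglongrightarrow> 0"
    using tendsto_add[OF tendsto_mult_left[OF conv, of K] limit(2)[OF x]] by simp
  then show ?thesis
    by (rule tendsto_sandwich[OF always_eventually always_eventually tendsto_const, rotated 2])
      (simp_all add: lower upper)
qed


section \<open>Series in a normed subspace\<close>

lemma norm_sums_unique:
  assumes B: "normed_subspace B N" and u: "\<And>i. u i \<in> B"
    and g: "norm_sums B N u g" and h: "norm_sums B N u h"
  shows "g = h"
proof -
  have gB: "g \<in> B" and hB: "h \<in> B" using g h by (auto simp: norm_sums_def)
  have S: "sum u {..<n} \<in> B" for n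
    using u by (intro subspace_sum normed_subspaceD(1)[OF B])
  have "N (g - h) \<le> N (sum u {..<n} - g) + N (sum u {..<n} - h)" for n
    using normed_subspace_diff_triangle[OF B gB S hB]
      normed_subspace_diff_commute[OF B gB S] by simp
  moreover have "(\<lambda>n. N (sum u {..<n} - g) + N (sum u {..<n} - h)) \<longlonglongrightarrow> 0"
    using g h by (intro tendsto_add_zero) (simp_all add: norm_sums_def)
  ultimately have "N (g - h) \<le> 0"
    by (intro LIMSEQ_le_const) auto
  moreover have "g - h \<in> B" using gB hB normed_subspaceD(1)[OF B] by (simp add: subspace_diff)
  ultimately have "g - h = 0"
    using normed_subspaceD(2,3)[OF B, of "g - h"] by simp
  then show ?thesis by simp
qed

lemma norm_sums_add:
  assumes B: "normed_subspace B N" and u: "\<And>i. u i \<in> B" and v: "\<And>i. v i \<in> B"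
    and g: "norm_sums B N u g" and h: "norm_sums B N v h"
  shows "norm_sums B N (\<lambda>i. u i + v i) (g + h)"
proof -
  note sB = normed_subspaceD(1)[OF B]
  have gB: "g \<in> B" and hB: "h \<in> B" using g h by (auto simp: norm_sums_def)
  have S: "sum u {..<n} - g \<in> B" "sum v {..<n} - h \<in> B" for n
    using u v gB hB by (auto intro!: subspace_sum subspace_diff sB)
  have eq: "(\<Sum>i<n. u i + v i) - (g + h) = (sum u {..<n} - g) + (sum v {..<n} - h)" for n
    by (simp add: sum.distrib)
  have le: "N ((\<Sum>i<n. u i + v i) - (g + h)) \<le> N (sum u {..<n} - g) + N (sum v {..<n} - h)" for n
    unfolding eq by (rule normed_subspaceD(5)[OF B S])
  have ge: "0 \<le> N ((\<Sum>i<n. u i + v i) - (g + h))" for n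
    unfolding eq by (rule normed_subspaceD(2)[OF B subspace_add[OF sB S]])
  have "(\<lambda>n. N (sum u {..<n} - g) + N (sum v {..<n} - h)) \<longlonglongrightarrow> 0"
    using g h by (intro tendsto_add_zero) (simp_all add: norm_sums_def)
  then have "(\<lambda>n. N ((\<Sum>i<n. u i + v i) - (g + h))) \<longlonglongrightarrow> 0"
    by (rule tendsto_sandwich[OF always_eventually always_eventually tendsto_const, rotated 2])
      (simp_all add: ge le)
  then show ?thesis using gB hB sB by (simp add: norm_sums_def subspace_add)
qed

lemma norm_sums_scaleR:
  assumes B: "normed_subspace B N" and u: "\<And>i. u i \<in> B" and g: "norm_sums B N u g"
  shows "norm_sums B N (\<lambda>i. c *\<^sub>R u i) (c *\<^sub>R g)"
proof -
  note sB = normed_subspaceD(1)[OF B]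
  have gB: "g \<in> B" using g by (auto simp: norm_sums_def)
  have S: "sum u {..<n} - g \<in> B" for n
    using u gB by (auto intro!: subspace_sum subspace_diff sB)
  have "N ((\<Sum>i<n. c *\<^sub>R u i) - c *\<^sub>R g) = \<bar>c\<bar> * N (sum u {..<n} - g)" for n
    using normed_subspaceD(4)[OF B S, of c] by (simp add: scaleR_sum_right algebra_simps)
  then show ?thesis
    using g gB sB by (simp add: norm_sums_def subspace_scale tendsto_mult_right_zero)
qed

text \<open>
  The Weierstrass test: the tails of the majorant make the partial sums Cauchy.
\<close>

lemma norm_sums_of_summable_bound:
  assumes B: "complete_normed_subspace B N" and u: "\<And>i. u i \<in> B"
    and bound: "\<And>i. N (u i) \<le> a i" and a: "summable a"
  obtains g where "norm_sums B N u g" "N g \<le> suminf a"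
proof -
  note nB = complete_normed_subspace_normed[OF B]
  note sB = normed_subspaceD(1)[OF nB]
  have S: "sum u I \<in> B" for I
    using u by (intro subspace_sum sB)
  have a0: "0 \<le> a i" for i
    using bound[of i] normed_subspaceD(2)[OF nB u[of i]] by simp
  have tail: "N (sum u {m..<n}) \<le> sum a {m..<n}" for m n
    using normed_subspace_sum[OF nB, of "{m..<n}" u] u sum_mono[of "{m..<n}" "\<lambda>i. N (u i)" a] bound
    by (auto intro: order_trans)
  have "\<exists>k. \<forall>m\<ge>k. \<forall>n\<ge>k. N (sum u {..<m} - sum u {..<n}) < e" if e: "e > 0" for e
  proof -
    obtain k where k: "\<And>m n. m \<ge> k \<Longrightarrow> norm (sum a {m..<n}) < e"
      using a e unfolding summable_Cauchy by blast
    have *: "N (sum u {..<n} - sum u {..<m}) < e" if "m \<le> n" "m \<ge> k" for m n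
    proof -
      have "sum u {..<n} - sum u {..<m} = sum u {m..<n}"
        using sum_diff_nat_ivl[of 0 m n u] that by (simp add: atLeast0LessThan)
      then show ?thesis using tail[of m n] k[of m n] that by simp
    qed
    show ?thesis
    proof (intro exI[of _ k] allI impI)
      fix m n assume mn: "m \<ge> k" "n \<ge> k"
      show "N (sum u {..<m} - sum u {..<n}) < e"
        using *[of m n] *[of n m] mn normed_subspace_diff_commute[OF nB S S, of "{..<m}" "{..<n}"]
        by (cases "m \<le> n") auto
    qed
  qed
  then obtain g where g: "g \<in> B" "(\<lambda>n. N (sum u {..<n} - g)) \<longlonglongrightarrow> 0"
    using complete_normed_subspace_limit[OF B, of "\<lambda>n. sum u {..<n}"] S by blast
  have "N g \<le> N (sum u {..<n} - g) + suminf a" for n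
  proof -
    have "N g \<le> N (sum u {..<n}) + N (sum u {..<n} - g)"
      using normed_subspace_diff[OF nB S[of "{..<n}"], of "sum u {..<n} - g"]
        subspace_diff[OF sB S g(1)] by simp
    moreover have "N (sum u {..<n}) \<le> suminf a"
      using tail[of 0 n] sum_le_suminf[OF a, of "{..<n}"] a0 by (simp add: atLeast0LessThan)
    ultimately show ?thesis by simp
  qed
  moreover have "(\<lambda>n. N (sum u {..<n} - g) + suminf a) \<longlonglongrightarrow> suminf a"
    using tendsto_add[OF g(2) tendsto_const] by simp
  ultimately have "N g \<le> suminf a"
    by (intro LIMSEQ_le_const) auto
  with g show thesis using that by (simp add: norm_sums_def)
qed

text \<open>
  The kernel of a continuous linear functional is closed. Applied to the mass, this keeps the sum
  of a Neumann series inside the space of measures of mass zero.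
\<close>

lemma norm_continuous_functional_sums_zero:
  fixes F :: "'v::real_vector \<Rightarrow> real"
  assumes cont: "norm_continuous B N abs F" and B: "subspace B"
    and F: "linear F" and u: "\<And>i. u i \<in> B" "\<And>i. F (u i) = 0"
    and g: "norm_sums B N u g"
  shows "F g = 0"
proof (rule ccontr)
  assume "F g \<noteq> 0"
  moreover have gB: "g \<in> B" using g by (simp add: norm_sums_def)
  ultimately obtain d where d: "d > 0" "\<And>y. y \<in> B \<Longrightarrow> N (y - g) < d \<Longrightarrow> \<bar>F y - F g\<bar> < \<bar>F g\<bar>"
    using cont unfolding norm_continuous_def by (meson zero_less_abs_iff)
  have "\<forall>\<^sub>F n in sequentially. N (sum u {..<n} - g) < d"
    using g d(1) by (auto simp: norm_sums_def intro: order_tendstoD(2))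
  then obtain n where "N (sum u {..<n} - g) < d"
    by (auto simp: eventually_sequentially)
  moreover have "sum u {..<n} \<in> B" using u B by (intro subspace_sum)
  moreover have "F (sum u {..<n}) = 0" using u by (simp add: linear_sum[OF F])
  ultimately show False using d(2)[of "sum u {..<n}"] by simp
qed


section \<open>The Neumann series under summable decay\<close>

text \<open>
  The powers of \<open>T\<close> decay only from the norm \<open>N\<close> to the weaker norm \<open>M\<close>, so the series is summed in
  the larger space \<open>W\<close> and its sum need not lie in \<open>V\<close>.
\<close>

locale summable_decay =
  fixes V W :: "'v::real_vector set" and N M :: "'v \<Rightarrow> real"
    and T :: "'v \<Rightarrow> 'v" and \<phi> :: "nat \<Rightarrow> real"
  assumes V: "normed_subspace V N"
    and W: "complete_normed_subspace W M"
    and subset: "V \<subseteq> W"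
    and linear: "linear T"
    and invariant: "\<And>g. g \<in> V \<Longrightarrow> T g \<in> V"
    and decay: "\<And>g n. g \<in> V \<Longrightarrow> M ((T ^^ n) g) \<le> \<phi> n * N g"
    and summable: "summable \<phi>"
begin

lemmas normed_W = complete_normed_subspace_normed[OF W]

lemma iterate_in: "g \<in> V \<Longrightarrow> (T ^^ n) g \<in> V"
  by (induction n) (auto simp: invariant)

lemma iterate_in_W: "g \<in> V \<Longrightarrow> (T ^^ n) g \<in> W"
  using iterate_in subset by blast

lemma linear_iterate: "linear (T ^^ n)"
proof (induction n)
  case (Suc n)
  then show ?case using linear_compose[OF Suc linear] by (simp only: funpow.simps)
qed (simp add: linear_ident)

lemma neumann_series_eqI:
  assumes "g \<in> V" "norm_sums W M (\<lambda>i. (T ^^ i) g) h"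
  shows "neumann_series T W M g = h"
  unfolding neumann_series_def using assms
  by (intro the_equality)
    (auto intro: norm_sums_unique[OF normed_W, of "\<lambda>i. (T ^^ i) g"] iterate_in_W)

text \<open>
  The majorant of the terms is \<open>\<phi> n * N g\<close>. Each of its terms bounds a norm and is therefore
  nonnegative, whatever the sign of \<open>\<phi> n\<close> may be when \<open>N g = 0\<close>.
\<close>

lemma neumann_sums_and_bound:
  assumes g: "g \<in> V"
  shows "norm_sums W M (\<lambda>i. (T ^^ i) g) (neumann_series T W M g) \<and>
    M (neumann_series T W M g) \<le> suminf \<phi> * N g"
proof -
  obtain h where h: "norm_sums W M (\<lambda>i. (T ^^ i) g) h" "M h \<le> (\<Sum>n. \<phi> n * N g)"
    by (rule norm_sums_of_summable_bound[OF W iterate_in_W[OF g] decay[OF g]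
          summable_mult2[OF summable]])
  then show ?thesis
    using neumann_series_eqI[OF g h(1)] suminf_mult2[OF summable, of "N g"] by simp
qed

lemmas neumann_sums = neumann_sums_and_bound[THEN conjunct1]
  and neumann_bound = neumann_sums_and_bound[THEN conjunct2]

lemma neumann_add:
  assumes g: "g \<in> V" and h: "h \<in> V"
  shows "neumann_series T W M (g + h) = neumann_series T W M g + neumann_series T W M h"
proof (rule neumann_series_eqI)
  show "g + h \<in> V" using g h normed_subspaceD(1)[OF V] by (simp add: subspace_add)
  show "norm_sums W M (\<lambda>i. (T ^^ i) (g + h)) (neumann_series T W M g + neumann_series T W M h)"
    using norm_sums_add[OF normed_W iterate_in_W[OF g] iterate_in_W[OF h] neumann_sums[OF g]
        neumann_sums[OF h]]
    by (simp add: linear_add[OF linear_iterate])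
qed

lemma neumann_scaleR:
  assumes g: "g \<in> V"
  shows "neumann_series T W M (c *\<^sub>R g) = c *\<^sub>R neumann_series T W M g"
proof (rule neumann_series_eqI)
  show "c *\<^sub>R g \<in> V" using g normed_subspaceD(1)[OF V] by (simp add: subspace_scale)
  show "norm_sums W M (\<lambda>i. (T ^^ i) (c *\<^sub>R g)) (c *\<^sub>R neumann_series T W M g)"
    using norm_sums_scaleR[OF normed_W iterate_in_W[OF g] neumann_sums[OF g]]
    by (simp add: linear_scale[OF linear_iterate])
qed

lemma neumann_diff:
  assumes g: "g \<in> V" and h: "h \<in> V"
  shows "neumann_series T W M (g - h) = neumann_series T W M g - neumann_series T W M h"
  using neumann_add[OF subspace_diff[OF normed_subspaceD(1)[OF V] g h] h] by (simp add: algebra_simps)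

lemma neumann_continuous: "norm_continuous V N M (neumann_series T W M)"
  unfolding norm_continuous_def
proof (intro ballI allI impI)
  fix x and e :: real
  assume x: "x \<in> V" and e: "e > 0"
  let ?K = "\<bar>suminf \<phi>\<bar> + 1"
  have K: "?K > 0" by (simp add: add_nonneg_pos)
  have "M (neumann_series T W M y - neumann_series T W M x) < e"
    if y: "y \<in> V" "N (y - x) < e / ?K" for y
  proof -
    have d: "y - x \<in> V" using subspace_diff[OF normed_subspaceD(1)[OF V] y(1) x] .
    have "M (neumann_series T W M y - neumann_series T W M x) \<le> suminf \<phi> * N (y - x)"
      using neumann_bound[OF d] neumann_diff[OF y(1) x] by simp
    also have "\<dots> \<le> ?K * N (y - x)"
      using normed_subspaceD(2)[OF V d] by (intro mult_right_mono) auto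
    also have "\<dots> < e" using y(2) K by (simp add: field_simps)
    finally show ?thesis .
  qed
  then show "\<exists>d>0. \<forall>y\<in>V. N (y - x) < d \<longrightarrow>
      M (neumann_series T W M y - neumann_series T W M x) < e"
    using e K by (intro exI[of _ "e / ?K"]) auto
qed

text \<open>
  The partial sums are \<open>h - (T ^^ n) h\<close>, and the remainder vanishes because \<open>\<phi>\<close>, being summable,
  tends to 0. This is the sense in which the Neumann series inverts \<open>1 - T\<close>.
\<close>

lemma norm_sums_telescope:
  assumes h: "h \<in> V"
  shows "norm_sums W M (\<lambda>i. (T ^^ i) (h - T h)) h"
proof -
  have "(\<Sum>i<n. (T ^^ i) (h - T h)) = h - (T ^^ n) h" for n
    by (induction n) (simp_all add: linear_diff[OF linear_iterate] funpow_swap1)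
  then have "M ((\<Sum>i<n. (T ^^ i) (h - T h)) - h) = M ((T ^^ n) h)" for n
    using normed_subspace_minus[OF normed_W iterate_in_W[OF h]] by simp
  moreover have "(\<lambda>n. M ((T ^^ n) h)) \<longlonglongrightarrow> 0"
  proof (rule tendsto_sandwich[OF _ _ tendsto_const])
    show "(\<lambda>n. \<phi> n * N h) \<longlonglongrightarrow> 0"
      using tendsto_mult_right[OF summable_LIMSEQ_zero[OF summable], of "N h"] by simp
  qed (auto intro!: always_eventually decay[OF h] normed_subspaceD(2)[OF normed_W iterate_in_W[OF h]])
  ultimately show ?thesis using h subset by (auto simp: norm_sums_def)
qed

lemma neumann_series_telescope:
  assumes h: "h \<in> V"
  shows "neumann_series T W M (h - T h) = h"
  using h invariant normed_subspaceD(1)[OF V]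
  by (intro neumann_series_eqI norm_sums_telescope) (auto simp: subspace_diff)

end


section \<open>Linear response\<close>

lemma linear_mass: "linear (mass :: 'a::topological_space signed_measure \<Rightarrow> real)"
proof
  fix \<mu> \<nu> :: "'a signed_measure" and c :: real
  show "mass (\<mu> + \<nu>) = mass \<mu> + mass \<nu>"
    unfolding mass_def by transfer simp
  show "mass (c *\<^sub>R \<mu>) = c *\<^sub>R mass \<mu>"
    unfolding mass_def by transfer simp
qed

lemma subspace_zero_mass: "subspace B \<Longrightarrow> subspace (zero_mass B)"
  unfolding subspace_def zero_mass_def
  by (auto simp: linear_0[OF linear_mass] linear_add[OF linear_mass] linear_scale[OF linear_mass])

lemma at_right_eq_at_within_Ioo:
  fixes a b :: real
  assumes "a < b"
  shows "at_right a = at a within {a<..<b}"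
  using assms by (intro at_within_nhd[of _ "{..<b}"]) auto

theorem theorem50:
  fixes Bss Bs Bw :: "'a::metric_space signed_measure set"
    and Nss Ns Nw :: "'a signed_measure \<Rightarrow> real"
    and L :: "real \<Rightarrow> 'a signed_measure \<Rightarrow> 'a signed_measure"
    and f :: "real \<Rightarrow> 'a signed_measure"
    and Ldot :: "'a signed_measure \<Rightarrow> 'a signed_measure"
    and \<phi> :: "nat \<Rightarrow> real"
    and \<delta>bar :: real
  assumes X_compact: "compact (UNIV :: 'a set)"
    and Bss: "complete_normed_subspace Bss Nss"
    and Bs: "complete_normed_subspace Bs Ns"
    and Bw: "complete_normed_subspace Bw Nw"
    and incl: "Bss \<subseteq> Bs" "Bs \<subseteq> Bw"
    and norm_s_ss: "\<forall>\<mu>\<in>Bss. Ns \<mu> \<le> Nss \<mu>"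
    and norm_w_s: "\<forall>\<mu>\<in>Bs. Nw \<mu> \<le> Ns \<mu>"
    and mass_cont: "norm_continuous Bss Nss abs mass"
      "norm_continuous Bs Ns abs mass" "norm_continuous Bw Nw abs mass"
    and \<delta>bar: "\<delta>bar > 0"
    and markov: "\<forall>\<delta>\<in>{0..<\<delta>bar}. markov_operator (L \<delta>)"
    and preserve: "\<forall>\<delta>\<in>{0..<\<delta>bar}. L \<delta> ` Bss \<subseteq> Bss \<and> L \<delta> ` Bs \<subseteq> Bs \<and> L \<delta> ` Bw \<subseteq> Bw"
    and L_cont: "\<forall>\<delta>\<in>{0..<\<delta>bar}. continuous_operator Bss Nss Bs Ns (L \<delta>)"
    and fixed: "\<forall>\<delta>\<in>{0..<\<delta>bar}. f \<delta> \<in> Bss \<and> probability_measure (f \<delta>) \<and> L \<delta> (f \<delta>) = f \<delta>"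
    and summable_speed: "summable \<phi>"
    and equilibrium: "convergence_to_equilibrium (L 0) Bs Ns Nw \<phi>"
    and stability: "((\<lambda>\<delta>. Nss (f \<delta> - f 0)) \<longlongrightarrow> 0) (at_right 0)"
    and Ldot: "continuous_operator Bss Nss (zero_mass Bs) Ns Ldot"
    and derivative: "\<forall>g\<in>Bss. ((\<lambda>\<delta>. Ns ((L \<delta> g - L 0 g) /\<^sub>R \<delta> - Ldot g)) \<longlongrightarrow> 0) (at_right 0)"
  shows "(\<forall>g\<in>zero_mass Bs. norm_sums Bw Nw (\<lambda>i. (L 0 ^^ i) g) (neumann_series (L 0) Bw Nw g)) \<and>
    continuous_operator (zero_mass Bs) Ns (zero_mass Bw) Nw (neumann_series (L 0) Bw Nw) \<and>
    ((\<lambda>\<delta>. Nw ((f \<delta> - f 0) /\<^sub>R \<delta> - neumann_series (L 0) Bw Nw (Ldot (f 0)))) \<longlongrightarrow> 0) (at_right 0)"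
proof -
  note nBss = complete_normed_subspace_normed[OF Bss]
    and nBs = complete_normed_subspace_normed[OF Bs]
    and nBw = complete_normed_subspace_normed[OF Bw]
  note sBs = normed_subspaceD(1)[OF nBs]
  have L0: "markov_operator (L 0)" using markov \<delta>bar by simp
  have V: "normed_subspace (zero_mass Bs) Ns"
    by (rule normed_subspace_subset[OF nBs subspace_zero_mass[OF sBs]]) (auto simp: zero_mass_def)
  note sV = normed_subspaceD(1)[OF V]
  interpret summable_decay "zero_mass Bs" Bw Ns Nw "L 0" \<phi>
  proof
    show "zero_mass Bs \<subseteq> Bw" using incl by (auto simp: zero_mass_def)
    show "L 0 g \<in> zero_mass Bs" if "g \<in> zero_mass Bs" for g
      using that bspec[OF preserve, of 0] \<delta>bar L0
      by (auto simp: zero_mass_def markov_operator_def)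
    show "Nw ((L 0 ^^ n) g) \<le> \<phi> n * Ns g" if "g \<in> zero_mass Bs" for g n
      using that equilibrium by (simp add: convergence_to_equilibrium_def)
  qed (use V Bw L0 summable_speed in \<open>auto simp: markov_operator_def linear_add linear_scale\<close>)
  let ?R = "neumann_series (L 0) Bw Nw"
  have R_in: "?R g \<in> zero_mass Bw" if g: "g \<in> zero_mass Bs" for g
  proof -
    have "mass (?R g) = 0"
      using iterate_in[OF g]
      by (intro norm_continuous_functional_sums_zero[OF mass_cont(3) normed_subspaceD(1)[OF nBw]
            linear_mass iterate_in_W[OF g] _ neumann_sums[OF g]])
        (auto simp: zero_mass_def)
    then show ?thesis using neumann_sums[OF g] by (simp add: zero_mass_def norm_sums_def)
  qed
  have R_cont: "continuous_operator (zero_mass Bs) Ns (zero_mass Bw) Nw ?R"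
    unfolding continuous_operator_def
    using R_in neumann_add neumann_scaleR neumann_continuous by blast

  define Q where "Q \<delta> x = (L \<delta> x - L 0 x) /\<^sub>R \<delta>" for \<delta> x
  have f0: "f 0 \<in> Bss" using fixed \<delta>bar by simp
  have Ldot_in: "Ldot g \<in> zero_mass Bs" if "g \<in> Bss" for g
    using continuous_operatorD(1)[OF Ldot that] .
  have Q_cont: "continuous_operator Bss Nss Bs Ns (Q \<delta>)" if "\<delta> \<in> {0<..<\<delta>bar}" for \<delta>
    unfolding Q_def using that L_cont \<delta>bar
    by (intro continuous_operator_scaleR[OF nBs]
        continuous_operator_diff[OF normed_subspaceD(1)[OF nBss] nBs]) auto
  \<comment> \<open>The fixed point equations turn \<open>(1 - L 0) (f \<delta> - f 0)\<close> into \<open>(L \<delta> - L 0) (f \<delta>)\<close>.\<close>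
  have quotient: "(f \<delta> - f 0) /\<^sub>R \<delta> = ?R (Q \<delta> (f \<delta>)) \<and> Q \<delta> (f \<delta>) \<in> zero_mass Bs"
    if \<delta>: "\<delta> \<in> {0<..<\<delta>bar}" for \<delta>
  proof -
    let ?h = "(f \<delta> - f 0) /\<^sub>R \<delta>"
    have fix\<delta>: "f \<delta> \<in> Bs" "f 0 \<in> Bs" "mass (f \<delta>) = 1" "mass (f 0) = 1"
      "L \<delta> (f \<delta>) = f \<delta>" "L 0 (f 0) = f 0"
      using fixed \<delta> incl by (auto simp: probability_measure_def)
    have h: "?h \<in> zero_mass Bs"
      using fix\<delta> sBs by (simp add: zero_mass_def subspace_scale subspace_diff
          linear_scale[OF linear_mass] linear_diff[OF linear_mass])
    have eq: "Q \<delta> (f \<delta>) = ?h - L 0 ?h"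
      using fix\<delta> by (simp add: Q_def linear_scale[OF linear] linear_diff[OF linear]
          scaleR_diff_right)
    show ?thesis
      unfolding eq using neumann_series_telescope[OF h] h invariant[OF h] sV
      by (simp add: subspace_diff)
  qed
  have at0: "at_right 0 = at (0::real) within {0<..<\<delta>bar}"
    by (rule at_right_eq_at_within_Ioo[OF \<delta>bar])
  \<comment> \<open>Sequences are used because there pointwise convergence bounds every orbit. For real \<open>\<delta>\<close> it gives
    bounds only near 0, on a neighbourhood that depends on the point.\<close>
  have Q_lim: "((\<lambda>\<delta>. Ns (Q \<delta> (f \<delta>) - Ldot (f 0))) \<longlongrightarrow> 0) (at_right 0)"
    unfolding at0 tendsto_at_iff_sequentially
  proof (intro allI impI)
    fix X :: "nat \<Rightarrow> real"
    assume X: "\<forall>i. X i \<in> {0<..<\<delta>bar} - {0}" "X \<longlonglongrightarrow> 0"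
    have along: "(\<lambda>n. F (X n)) \<longlonglongrightarrow> 0" if "(F \<longlongrightarrow> 0) (at_right 0)" for F :: "real \<Rightarrow> real"
      using that X unfolding at0 tendsto_at_iff_sequentially comp_def by blast
    have "(\<lambda>n. Ns (Q (X n) (f (X n)) - Ldot (f 0))) \<longlonglongrightarrow> 0"
    proof (rule operators_converge_at_moving_point[where S = Ldot and T = "\<lambda>n. Q (X n)", OF Bss nBs])
      show "continuous_operator Bss Nss Bs Ns (Q (X n))" for n using X(1) Q_cont by blast
      show "Ldot y \<in> Bs" if "y \<in> Bss" for y using Ldot_in[OF that] by (simp add: zero_mass_def)
      show "(\<lambda>n. Ns (Q (X n) y - Ldot y)) \<longlonglongrightarrow> 0" if "y \<in> Bss" for y
        using along derivative that unfolding Q_def by blast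
      show "f (X n) \<in> Bss" for n using X(1) fixed by (simp add: less_imp_le)
      show "(\<lambda>n. Nss (f (X n) - f 0)) \<longlonglongrightarrow> 0" by (rule along[OF stability])
    qed (rule f0)
    then show "((\<lambda>\<delta>. Ns (Q \<delta> (f \<delta>) - Ldot (f 0))) \<circ> X) \<longlonglongrightarrow> 0" by (simp add: comp_def)
  qed
  have bounds: "0 \<le> Nw ((f \<delta> - f 0) /\<^sub>R \<delta> - ?R (Ldot (f 0))) \<and>
      Nw ((f \<delta> - f 0) /\<^sub>R \<delta> - ?R (Ldot (f 0))) \<le> suminf \<phi> * Ns (Q \<delta> (f \<delta>) - Ldot (f 0))"
    if \<delta>: "\<delta> \<in> {0<..<\<delta>bar}" for \<delta>
  proof -
    note q = quotient[OF \<delta>]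
    have d: "Q \<delta> (f \<delta>) - Ldot (f 0) \<in> zero_mass Bs"
      using q Ldot_in[OF f0] sV by (simp add: subspace_diff)
    have eq: "(f \<delta> - f 0) /\<^sub>R \<delta> - ?R (Ldot (f 0)) = ?R (Q \<delta> (f \<delta>) - Ldot (f 0))"
      using q neumann_diff[OF _ Ldot_in[OF f0], of "Q \<delta> (f \<delta>)"] by simp
    have "?R (Q \<delta> (f \<delta>) - Ldot (f 0)) \<in> Bw" using neumann_sums[OF d] by (simp add: norm_sums_def)
    then show ?thesis unfolding eq using neumann_bound[OF d] normed_subspaceD(2)[OF nBw] by blast
  qed
  have near: "\<forall>\<^sub>F \<delta> in at_right 0. \<delta> \<in> {0<..<\<delta>bar}"
    unfolding at0 by (simp add: eventually_at_filter)
  have "((\<lambda>\<delta>. Nw ((f \<delta> - f 0) /\<^sub>R \<delta> - ?R (Ldot (f 0)))) \<longlongrightarrow> 0) (at_right 0)"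
  proof (rule tendsto_sandwich[OF _ _ tendsto_const])
    show "((\<lambda>\<delta>. suminf \<phi> * Ns (Q \<delta> (f \<delta>) - Ldot (f 0))) \<longlongrightarrow> 0) (at_right 0)"
      using tendsto_mult_left[OF Q_lim, of "suminf \<phi>"] by simp
  qed (use bounds in \<open>auto intro: eventually_mono[OF near]\<close>)
  then show ?thesis using neumann_sums R_cont by blast
qed

end
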